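(* Let $n\ge4$. There is a bijective correspondence, induced by the embedding $(v,w)\mapsto[1:v:v^2:v^3:w]$ of the higher Cauchy data plane into $\mathscr S_3$, between the joint absolute rational invariants with respect to the action of the restriction of $\mathscr P$ to the product of the higher Cauchy data planes $\mathbb{C}^2\times\cdots\times\mathbb{C}^2$ ($n$ times) and the geometric joint absolute (rational) invariants with respect to the action of $G$ on $\mathscr S_3\times\cdots\times\mathscr S_3$ ($n$ times).
   Context: The higher Cauchy data plane is the plane $\mathbb{C}^2(u',u'')$ of pairs $(v,w)=(u',u'')$ above a given point $(x,u)\in\mathbb{C}^2$. The pseudogroup $\mathscr P$ of point transformations $X=\phi(x,u)$, $U=\psi(x,u)$ ($\phi,\psi$ holomorphic, Jacobian nonzero) acts on it through the eight-parameter group of (rational) transformations $$V=\frac{av+b}{cv+d},\qquad W=\frac{\lambda+\mu v+\nu v^2+\xi v^3+(ad-bc)w}{(cv+d)^3},$$ with $a,b,c,d,\lambda,\mu,\nu,\xi\in\mathbb{C}$, $ad-bc\ne0$; this is "the restriction of $\mathscr P$". It acts simultaneously on $n$ elements $(v_1,w_1),\dots,(v_n,w_n)$, and a joint absolute rational invariant is a rational function of the $v_k,w_k$ unchanged by this joint action. $\mathscr S_3\subset\mathbb{C}P_4$ is the cubic cone (the point-cone with vertex $[0:0:0:0:1]$ over the twisted cubic) $$z_1z_3-z_2^2=0,\quad z_2z_3-z_1z_4=0,\quad z_3^2-z_2z_4=0.$$ $G$ is the group of projective transformations of $\mathbb{C}P_4$ preserving $\mathscr S_3$ given by $$\begin{aligned}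 Z_1&=d^3z_1+3cd^2z_2+3c^2dz_3+c^3z_4\\ Z_2&=bd^2z_1+d(ad+2bc)z_2+c(bc+2ad)z_3+ac^2z_4\\ Z_3&=b^2dz_1+b(bc+2ad)z_2+a(ad+2bc)z_3+a^2cz_4\\ Z_4&=b^3z_1+3ab^2z_2+3a^2bz_3+a^3z_4\\ Z_5&=\lambda z_1+\mu z_2+\nu z_3+\xi z_4+(ad-bc)z_5 \end{aligned}$$ with the same parameters $a,b,c,d,\lambda,\mu,\nu,\xi$, $ad-bc\neq0$. It acts diagonally on $\mathscr S_3\times\cdots\times\mathscr S_3$; its joint absolute invariants are the rational functions on this product unchanged by the diagonal action. *)

theory Defs
  imports "HOL-Analysis.Analysis"
begin

section \<open>Polynomial functions and rational functions\<close>

text \<open>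
  A point of an \<open>n\<close>-fold product of \<open>d\<close>-dimensional complex spaces is an element \<open>x\<close> of
  \<open>complex ^ 'd ^ 'n\<close>, with \<open>x $ k\<close> the \<open>k\<close>-th factor; \<open>n\<close> is \<open>CARD('n)\<close>.  As the complex
  field is infinite, polynomials in the coordinates are identified with the functions they define
  (compare \<open>real_polynomial_function\<close> in HOL-Analysis).
\<close>

inductive_set poly_funs :: "(complex ^ 'd ^ 'n \<Rightarrow> complex) set" where
  const: "(\<lambda>x. c) \<in> poly_funs"
| coord: "(\<lambda>x. x $ k $ i) \<in> poly_funs"
| add: "P \<in> poly_funs \<Longrightarrow> Q \<in> poly_funs \<Longrightarrow> (\<lambda>x. P x + Q x) \<in> poly_funs"
| mult: "P \<in> poly_funs \<Longrightarrow> Q \<in> poly_funs \<Longrightarrow> (\<lambda>x. P x * Q x) \<in> poly_funs"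

text \<open>A fraction \<open>P / Q\<close> is the pair \<open>(P, Q)\<close>; a rational function is a class of fractions.\<close>

type_synonym ('d, 'n) fraction =
  "(complex ^ 'd ^ 'n \<Rightarrow> complex) \<times> (complex ^ 'd ^ 'n \<Rightarrow> complex)"

type_synonym ('d, 'n) ratfun = "('d, 'n) fraction set"

definition same_fraction ::
  "(complex ^ 'd ^ 'n) set \<Rightarrow> ('d, 'n) fraction set \<Rightarrow> ('d, 'n) fraction rel" where
  "same_fraction X F =
     {((P, Q), (P', Q')). (P, Q) \<in> F \<and> (P', Q') \<in> F \<and> (\<forall>x\<in>X. P x * Q' x = P' x * Q x)}"

text \<open>
  The pullback \<open>R \<circ> \<phi>\<close> of a rational function \<open>R\<close> along a map \<open>\<phi>\<close> defined on \<open>D\<close>: the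
  set of all fractions, among the fractions \<open>F\<close> admitted on the source of \<open>\<phi>\<close>, that represent it.
  It is used only for maps \<open>\<phi>\<close> with dense \<open>D\<close> and dense image, so that no denominator \<open>Q\<close> of \<open>R\<close>
  becomes identically zero and the result is again a class of fractions.
\<close>

definition pullback ::
  "('d, 'n) fraction set \<Rightarrow> (complex ^ 'd ^ 'n) set \<Rightarrow> (complex ^ 'd ^ 'n \<Rightarrow> complex ^ 'e ^ 'n)
     \<Rightarrow> ('e, 'n) ratfun \<Rightarrow> ('d, 'n) ratfun" where
  "pullback F D \<phi> R =
     {(P', Q') \<in> F. \<exists>(P, Q) \<in> R. \<forall>y\<in>D. P' y * Q (\<phi> y) = P (\<phi> y) * Q' y}"

definition diagonal :: "('a \<Rightarrow> 'b) \<Rightarrow> 'a ^ 'n \<Rightarrow> 'b ^ 'n" where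
  "diagonal f x = (\<chi> k. f (x $ k))"


section \<open>Products of higher Cauchy data planes\<close>

text \<open>An element \<open>(v, w)\<close> of the plane is \<open>p\<close> with \<open>v = p $ 1\<close> and \<open>w = p $ 2\<close>.
  The parameter usually written as lambda is called \<open>l\<close>.\<close>

definition cauchy_fractions :: "(2, 'n::finite) fraction set" where
  "cauchy_fractions = {(P, Q). P \<in> poly_funs \<and> Q \<in> poly_funs \<and> (\<exists>x. Q x \<noteq> 0)}"

definition cauchy_ratfuns :: "(2, 'n::finite) ratfun set" where
  "cauchy_ratfuns = cauchy_fractions // same_fraction UNIV cauchy_fractions"

definition cauchy_transf ::
  "complex \<Rightarrow> complex \<Rightarrow> complex \<Rightarrow> complex \<Rightarrow> complex \<Rightarrow> complex \<Rightarrow> complex \<Rightarrow> complex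
     \<Rightarrow> complex ^ 2 \<Rightarrow> complex ^ 2" where
  "cauchy_transf a b c d l \<mu> \<nu> \<xi> p =
     (let v = p $ 1; w = p $ 2 in
      vector [(a * v + b) / (c * v + d),
              (l + \<mu> * v + \<nu> * v^2 + \<xi> * v^3 + (a * d - b * c) * w) / (c * v + d)^3])"

text \<open>The transformations are rational; jointly they are defined where no \<open>c v\<^sub>k + d\<close> vanishes.\<close>

definition cauchy_invariants :: "(2, 'n::finite) ratfun set" where
  "cauchy_invariants =
     {R \<in> cauchy_ratfuns. \<forall>a b c d l \<mu> \<nu> \<xi>. a * d - b * c \<noteq> 0 \<longrightarrow>
        pullback cauchy_fractions {x. \<forall>k. c * x $ k $ 1 + d \<noteq> 0}
          (diagonal (cauchy_transf a b c d l \<mu> \<nu> \<xi>)) R = R}"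


section \<open>Products of the cubic cone\<close>

text \<open>
  Points of complex projective 4-space are given by their nonzero homogeneous coordinate vectors
  in \<open>complex ^ 5\<close>; thus \<open>cubic_cone\<close> consists of all homogeneous coordinate vectors of the points
  of the cone.
\<close>

definition cubic_cone :: "(complex ^ 5) set" where
  "cubic_cone = {z. z \<noteq> 0 \<and>
     z $ 1 * z $ 3 - (z $ 2)^2 = 0 \<and>
     z $ 2 * z $ 3 - z $ 1 * z $ 4 = 0 \<and>
     (z $ 3)^2 - z $ 2 * z $ 4 = 0}"

definition cone_product :: "(complex ^ 5 ^ 'n) set" where
  "cone_product = {z. \<forall>k. z $ k \<in> cubic_cone}"

text \<open>\<open>P\<close> is homogeneous of degree \<open>e k\<close> in the coordinates of the \<open>k\<close>-th factor, for every \<open>k\<close>.\<close>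

definition multihomogeneous :: "('n \<Rightarrow> nat) \<Rightarrow> (complex ^ 'd ^ 'n \<Rightarrow> complex) \<Rightarrow> bool" where
  "multihomogeneous e P \<longleftrightarrow>
     (\<forall>k t z. P (\<chi> j. if j = k then t *s z $ j else z $ j) = t ^ e k * P z)"

text \<open>
  Rational functions on a product of projective varieties: quotients of multihomogeneous polynomials
  of equal multidegree whose denominator does not vanish identically on the product.
\<close>

definition cone_fractions :: "(5, 'n::finite) fraction set" where
  "cone_fractions = {(P, Q). P \<in> poly_funs \<and> Q \<in> poly_funs \<and>
     (\<exists>e. multihomogeneous e P \<and> multihomogeneous e Q) \<and> (\<exists>z\<in>cone_product. Q z \<noteq> 0)}"

definition cone_ratfuns :: "(5, 'n::finite) ratfun set" where
  "cone_ratfuns = cone_fractions // same_fraction cone_product cone_fractions"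

definition cone_transf ::
  "complex \<Rightarrow> complex \<Rightarrow> complex \<Rightarrow> complex \<Rightarrow> complex \<Rightarrow> complex \<Rightarrow> complex \<Rightarrow> complex
     \<Rightarrow> complex ^ 5 \<Rightarrow> complex ^ 5" where
  "cone_transf a b c d l \<mu> \<nu> \<xi> z =
     (let z1 = z $ 1; z2 = z $ 2; z3 = z $ 3; z4 = z $ 4; z5 = z $ 5 in
      vector
       [d^3 * z1 + 3 * c * d^2 * z2 + 3 * c^2 * d * z3 + c^3 * z4,
        b * d^2 * z1 + d * (a * d + 2 * b * c) * z2 + c * (b * c + 2 * a * d) * z3 + a * c^2 * z4,
        b^2 * d * z1 + b * (b * c + 2 * a * d) * z2 + a * (a * d + 2 * b * c) * z3 + a^2 * c * z4,
        b^3 * z1 + 3 * a * b^2 * z2 + 3 * a^2 * b * z3 + a^3 * z4,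
        l * z1 + \<mu> * z2 + \<nu> * z3 + \<xi> * z4 + (a * d - b * c) * z5])"

definition cone_invariants :: "(5, 'n::finite) ratfun set" where
  "cone_invariants =
     {R \<in> cone_ratfuns. \<forall>a b c d l \<mu> \<nu> \<xi>. a * d - b * c \<noteq> 0 \<longrightarrow>
        pullback cone_fractions cone_product (diagonal (cone_transf a b c d l \<mu> \<nu> \<xi>)) R = R}"


section \<open>The embedding\<close>

definition cauchy_embedding :: "complex ^ 2 \<Rightarrow> complex ^ 5" where
  "cauchy_embedding p = (let v = p $ 1; w = p $ 2 in vector [1, v, v^2, v^3, w])"

definition embedding_pullback :: "(5, 'n::finite) ratfun \<Rightarrow> (2, 'n) ratfun" where
  "embedding_pullback = pullback cauchy_fractions UNIV (diagonal cauchy_embedding)"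

end

theory Submission
  imports Defs
begin

text \<open>
  Writing \<open>E\<close> for the diagonal embedding and \<open>E\<^sup>*\<close> for composition of a fraction with \<open>E\<close>,
  homogenization (with the first coordinate of each factor as the homogenizing variable) shows that
  \<open>E\<^sup>*\<close> maps the fractions on the product of cones \<^emph>\<open>onto\<close> the fractions on the product of planes.
  The multiples of points \<open>E x\<close> are dense in the product of cones, so \<open>E\<^sup>*\<close> also reflects equality of
  rational functions, and it induces a bijection of rational functions.  It respects the actions
  because \<open>cone_transf (E p) = (c v + d)\<^sup>3 E (cauchy_transf p)\<close>, and the factors \<open>(c v + d)\<^sup>3\<close> cancel
  in fractions with numerator and denominator of the same multidegree.
\<close>

section \<open>Polynomial functions\<close>

lemma poly_funs_prod:
  assumes "finite A" "\<And>k. k \<in> A \<Longrightarrow> f k \<in> poly_funs"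
  shows "(\<lambda>x. \<Prod>k\<in>A. f k x) \<in> poly_funs"
  using assms by (induction A rule: finite_induct) (auto intro: poly_funs.intros)

lemma poly_funs_power: "P \<in> poly_funs \<Longrightarrow> (\<lambda>x. P x ^ m) \<in> poly_funs"
  by (induction m) (auto intro: poly_funs.intros)

lemma poly_funs_diff:
  assumes "P \<in> poly_funs" "Q \<in> poly_funs"
  shows "(\<lambda>x. P x - Q x) \<in> poly_funs"
proof -
  have "(\<lambda>x. P x + (-1) * Q x) \<in> poly_funs"
    by (intro poly_funs.intros assms)
  then show ?thesis by simp
qed

lemma poly_funs_compose:
  assumes "P \<in> poly_funs" "\<And>k i. (\<lambda>x. \<phi> x $ k $ i) \<in> poly_funs"
  shows "(\<lambda>x. P (\<phi> x)) \<in> poly_funs"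
  using assms(1) by (induction rule: poly_funs.induct) (auto intro: poly_funs.intros assms(2))

text \<open>Continuity, in coordinatewise form so that it applies directly to an explicitly
  parametrized curve.\<close>

lemma poly_funs_tendsto:
  assumes "P \<in> poly_funs" "\<And>k i. ((\<lambda>t. \<gamma> t $ k $ i) \<longlongrightarrow> x $ k $ i) F"
  shows "((\<lambda>t. P (\<gamma> t)) \<longlongrightarrow> P x) F"
  using assms(1) by (induction rule: poly_funs.induct) (auto intro!: tendsto_intros assms(2))

lemma poly_funs_line:
  assumes "P \<in> poly_funs"
  shows "\<exists>p. \<forall>t. P (\<chi> k i. x $ k $ i + t * (y $ k $ i - x $ k $ i)) = poly p t"
  using assms
proof (induction rule: poly_funs.induct)
  case (const c)
  have "\<forall>t. c = poly [:c:] t" by simp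
  then show ?case by blast
next
  case (coord k i)
  show ?case
    by (intro exI[of _ "[:x $ k $ i, y $ k $ i - x $ k $ i:]"]) simp
next
  case (add P Q)
  then obtain p q where "\<forall>t. P (\<chi> k i. x $ k $ i + t * (y $ k $ i - x $ k $ i)) = poly p t"
    "\<forall>t. Q (\<chi> k i. x $ k $ i + t * (y $ k $ i - x $ k $ i)) = poly q t"
    by blast
  then show ?case by (intro exI[of _ "p + q"]) simp
next
  case (mult P Q)
  then obtain p q where "\<forall>t. P (\<chi> k i. x $ k $ i + t * (y $ k $ i - x $ k $ i)) = poly p t"
    "\<forall>t. Q (\<chi> k i. x $ k $ i + t * (y $ k $ i - x $ k $ i)) = poly q t"
    by blast
  then show ?case by (intro exI[of _ "p * q"]) simp
qed

text \<open>Restricted to the line through \<open>x\<close> (at 0) and \<open>y\<close> (at 1), both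
  factors become polynomials in one variable, which form an integral domain.\<close>

lemma poly_funs_no_zero_divisors:
  assumes P: "P \<in> poly_funs" and Q: "Q \<in> poly_funs" and PQ: "\<And>z. P z * Q z = 0" and x: "P x \<noteq> 0"
  shows "Q y = 0"
proof -
  let ?l = "\<lambda>t. \<chi> k i. x $ k $ i + t * (y $ k $ i - x $ k $ i)"
  obtain p q where p: "\<And>t. P (?l t) = poly p t" and q: "\<And>t. Q (?l t) = poly q t"
    using poly_funs_line[OF P, of x y] poly_funs_line[OF Q, of x y] by blast
  have l: "?l 0 = x" "?l 1 = y"
    by (simp_all add: vec_eq_iff)
  have "poly (p * q) t = 0" for t
    using PQ[of "?l t"] by (simp add: p q)
  then have "p * q = 0"
    using poly_all_0_iff_0 by blast
  moreover have "p \<noteq> 0"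
    using x p[of 0] l by auto
  ultimately have "q = 0" by simp
  then show ?thesis using q[of 1] l by simp
qed

section \<open>Multihomogeneous functions\<close>

definition scale :: "('n \<Rightarrow> complex) \<Rightarrow> complex ^ 'd ^ 'n \<Rightarrow> complex ^ 'd ^ 'n" where
  "scale s z = (\<chi> k. s k *s z $ k)"

lemma multihomogeneousD:
  "multihomogeneous e P \<Longrightarrow> P (\<chi> j. if j = k then t *s z $ j else z $ j) = t ^ e k * P z"
  by (simp add: multihomogeneous_def)

text \<open>\<open>multihomogeneous\<close> rescales one factor at a time; induction on the set
  \<open>A\<close> of factors already rescaled treats all of them.\<close>

lemma multihomogeneous_scale:
  fixes z :: "complex ^ 'd ^ 'n::finite"
  assumes "multihomogeneous e P"
  shows "P (scale s z) = (\<Prod>k\<in>UNIV. s k ^ e k) * P z"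
proof -
  have "P (\<chi> k. if k \<in> A then s k *s z $ k else z $ k) = (\<Prod>k\<in>A. s k ^ e k) * P z"
    if "finite A" for A
    using that
  proof (induction A rule: finite_induct)
    case (insert a A)
    let ?w = "\<chi> k. if k \<in> A then s k *s z $ k else z $ k"
    have eq: "(\<chi> k. if k \<in> insert a A then s k *s z $ k else z $ k)
        = (\<chi> j. if j = a then s a *s ?w $ j else ?w $ j)"
      using insert.hyps by (auto simp: vec_eq_iff)
    have "P (\<chi> k. if k \<in> insert a A then s k *s z $ k else z $ k) = s a ^ e a * P ?w"
      unfolding eq by (rule multihomogeneousD[OF assms])
    then show ?case using insert by simp
  qed simp
  from this[of UNIV] show ?thesis
    by (simp add: scale_def)
qed

lemma multihomogeneous_mult:
  assumes "multihomogeneous e P" "multihomogeneous e' Q"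
  shows "multihomogeneous (\<lambda>k. e k + e' k) (\<lambda>z. P z * Q z)"
  using assms unfolding multihomogeneous_def by (simp add: power_add)

lemma multihomogeneous_add:
  assumes "multihomogeneous e P" "multihomogeneous e Q"
  shows "multihomogeneous e (\<lambda>z. P z + Q z)"
  using assms unfolding multihomogeneous_def by (simp add: algebra_simps)

lemma multihomogeneous_diff:
  assumes "multihomogeneous e P" "multihomogeneous e Q"
  shows "multihomogeneous e (\<lambda>z. P z - Q z)"
  using assms unfolding multihomogeneous_def by (simp add: algebra_simps)

lemma multihomogeneous_diagonal:
  assumes P: "multihomogeneous e P" and f: "\<And>t z. f (t *s z) = t *s f z"
  shows "multihomogeneous e (\<lambda>z. P (diagonal f z))"
proof -
  have eq: "diagonal f (\<chi> j. if j = k then t *s z $ j else z $ j)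
      = (\<chi> j. if j = k then t *s diagonal f z $ j else diagonal f z $ j)" for k t z
    by (auto simp: diagonal_def vec_eq_iff f)
  show ?thesis
    unfolding multihomogeneous_def eq by (intro allI multihomogeneousD[OF P])
qed

lemma multihomogeneous_monomial:
  fixes i :: "'d::finite"
  shows "multihomogeneous e (\<lambda>z :: complex ^ 'd ^ 'n::finite. \<Prod>k\<in>UNIV. z $ k $ i ^ e k)"
  unfolding multihomogeneous_def
proof (intro allI)
  fix k t and z :: "complex ^ 'd ^ 'n"
  have "(\<Prod>l\<in>UNIV. (\<chi> j. if j = k then t *s z $ j else z $ j) $ l $ i ^ e l)
      = (\<Prod>l\<in>UNIV. (if l = k then t ^ e l else 1) * z $ l $ i ^ e l)"
    by (intro prod.cong) (auto simp: power_mult_distrib)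
  also have "\<dots> = t ^ e k * (\<Prod>l\<in>UNIV. z $ l $ i ^ e l)"
    by (simp add: prod.distrib)
  finally show "(\<Prod>l\<in>UNIV. (\<chi> j. if j = k then t *s z $ j else z $ j) $ l $ i ^ e l)
      = t ^ e k * (\<Prod>l\<in>UNIV. z $ l $ i ^ e l)" .
qed

section \<open>The embedding into the product of cones\<close>

lemma exhaust_5: "x = 1 \<or> x = 2 \<or> x = 3 \<or> x = 4 \<or> x = 5" for x :: 5
proof (induct x)
  case (of_int z)
  then have "z = 0 \<or> z = 1 \<or> z = 2 \<or> z = 3 \<or> z = 4" by fastforce
  then show ?case by auto
qed

lemma forall_5: "(\<forall>i::5. P i) \<longleftrightarrow> P 1 \<and> P 2 \<and> P 3 \<and> P 4 \<and> P 5"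
  by (metis exhaust_5)

lemma vector_5 [simp]:
  "(vector [x1, x2, x3, x4, x5] :: 'a::zero ^ 5) $ 1 = x1"
  "(vector [x1, x2, x3, x4, x5] :: 'a::zero ^ 5) $ 2 = x2"
  "(vector [x1, x2, x3, x4, x5] :: 'a::zero ^ 5) $ 3 = x3"
  "(vector [x1, x2, x3, x4, x5] :: 'a::zero ^ 5) $ 4 = x4"
  "(vector [x1, x2, x3, x4, x5] :: 'a::zero ^ 5) $ 5 = x5"
  by (simp_all add: vector_def)

abbreviation embed :: "complex ^ 2 ^ 'n \<Rightarrow> complex ^ 5 ^ 'n" where
  "embed \<equiv> diagonal cauchy_embedding"

lemma cauchy_embedding_nth [simp]:
  "cauchy_embedding p $ 1 = 1"
  "cauchy_embedding p $ 2 = p $ 1"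
  "cauchy_embedding p $ 3 = (p $ 1)^2"
  "cauchy_embedding p $ 4 = (p $ 1)^3"
  "cauchy_embedding p $ 5 = p $ 2"
  by (simp_all add: cauchy_embedding_def Let_def)

lemma embed_in_cone_product: "embed x \<in> cone_product"
proof -
  have "cauchy_embedding p \<noteq> 0" for p
    by (metis cauchy_embedding_nth(1) zero_index zero_neq_one)
  then show ?thesis
    by (auto simp: cone_product_def cubic_cone_def diagonal_def power2_eq_square power3_eq_cube)
qed

lemma poly_funs_embed:
  fixes P :: "complex ^ 5 ^ 'n::finite \<Rightarrow> complex"
  assumes "P \<in> poly_funs"
  shows "(\<lambda>x. P (embed x)) \<in> poly_funs"
proof (rule poly_funs_compose[OF assms])
  fix k :: 'n and i :: 5
  have "\<forall>i. (\<lambda>x :: complex ^ 2 ^ 'n. embed x $ k $ i) \<in> poly_funs"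
    unfolding forall_5 by (auto simp: diagonal_def intro: poly_funs.intros poly_funs_power)
  then show "(\<lambda>x :: complex ^ 2 ^ 'n. embed x $ k $ i) \<in> poly_funs" by blast
qed

section \<open>Homogenization\<close>

text \<open>Multiplication by this monomial raises the multidegree by \<open>e\<close> without
  changing the restriction to embedded points, whose first coordinates are 1.\<close>

definition homogenizing_monomial :: "('n \<Rightarrow> nat) \<Rightarrow> complex ^ 5 ^ 'n::finite \<Rightarrow> complex" where
  "homogenizing_monomial e z = (\<Prod>k\<in>UNIV. z $ k $ 1 ^ e k)"

lemma homogenizing_monomial:
  "homogenizing_monomial e \<in> poly_funs"
  "multihomogeneous e (homogenizing_monomial e)"
  "homogenizing_monomial e (embed x) = 1"
  unfolding homogenizing_monomial_def
  by (auto intro!: poly_funs_prod poly_funs_power poly_funs.coord multihomogeneous_monomial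
      simp: diagonal_def)

lemma homogenization:
  fixes p :: "complex ^ 2 ^ 'n::finite \<Rightarrow> complex"
  assumes "p \<in> poly_funs"
  shows "\<exists>P e. P \<in> poly_funs \<and> multihomogeneous e P \<and> (\<forall>x. P (embed x) = p x)"
  using assms
proof (induction rule: poly_funs.induct)
  case (const c)
  have "multihomogeneous (\<lambda>_. 0) (\<lambda>z. c)" by (simp add: multihomogeneous_def)
  then show ?case using poly_funs.const by blast
next
  case (coord k i)
  \<comment> \<open>The embedding places \<open>v\<close> in coordinate 2 and \<open>w\<close> in
    coordinate 5.\<close>
  define j :: 5 where "j = (if i = 1 then 2 else 5)"
  have "multihomogeneous (\<lambda>l. if l = k then 1 else 0) (\<lambda>z :: complex ^ 5 ^ 'n. z $ k $ j)"
    by (simp add: multihomogeneous_def)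
  moreover have "embed x $ k $ j = x $ k $ i" for x
    using exhaust_2[of i] by (auto simp: j_def diagonal_def)
  ultimately show ?case using poly_funs.coord by blast
next
  case (add p q)
  then obtain P e Q e' where P: "P \<in> poly_funs" "multihomogeneous e P" "\<forall>x. P (embed x) = p x"
    and Q: "Q \<in> poly_funs" "multihomogeneous e' Q" "\<forall>x. Q (embed x) = q x"
    by blast
  \<comment> \<open>The two summands may have different multidegrees; each is raised to the common
    one, \<open>e + e'\<close>.\<close>
  let ?H = "\<lambda>z. P z * homogenizing_monomial e' z + homogenizing_monomial e z * Q z"
  have "?H \<in> poly_funs"
    by (intro poly_funs.intros P Q homogenizing_monomial)
  moreover have "multihomogeneous (\<lambda>k. e k + e' k) ?H"
    by (intro multihomogeneous_add multihomogeneous_mult P Q homogenizing_monomial)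
  moreover have "\<forall>x. ?H (embed x) = p x + q x"
    using P Q by (simp add: homogenizing_monomial)
  ultimately show ?case by blast
next
  case (mult p q)
  then obtain P e Q e' where P: "P \<in> poly_funs" "multihomogeneous e P" "\<forall>x. P (embed x) = p x"
    and Q: "Q \<in> poly_funs" "multihomogeneous e' Q" "\<forall>x. Q (embed x) = q x"
    by blast
  let ?H = "\<lambda>z. P z * Q z"
  have "?H \<in> poly_funs"
    by (intro poly_funs.intros P Q)
  moreover have "multihomogeneous (\<lambda>k. e k + e' k) ?H"
    by (intro multihomogeneous_mult P Q)
  moreover have "\<forall>x. ?H (embed x) = p x * q x"
    using P Q by simp
  ultimately show ?case by blast
qed

section \<open>Density of the embedded points\<close>

text \<open>Homogeneous parameters of the twisted cubic are used so that its point at infinity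
  (\<open>\<alpha> = 0\<close>) is reached as well; \<open>s = 0\<close> gives the vertex.\<close>

lemma cubic_cone_parametrization:
  assumes "z \<in> cubic_cone"
  shows "\<exists>s \<alpha> \<beta>. z $ 1 = s * \<alpha>^3 \<and> z $ 2 = s * \<alpha>^2 * \<beta> \<and> z $ 3 = s * \<alpha> * \<beta>^2 \<and> z $ 4 = s * \<beta>^3"
proof (cases "z $ 1 = 0")
  case True
  then have "z $ 2 = 0" "z $ 3 = 0"
    using assms by (auto simp: cubic_cone_def)
  then show ?thesis
    using True by (intro exI[of _ "z $ 4"] exI[of _ 0] exI[of _ 1]) auto
next
  case False
  have 3: "z $ 3 = (z $ 2)^2 / z $ 1"
    using assms False by (simp add: cubic_cone_def field_simps)
  have "z $ 4 = z $ 2 * z $ 3 / z $ 1"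
    using assms False by (simp add: cubic_cone_def field_simps)
  then have 4: "z $ 4 = (z $ 2)^3 / (z $ 1)^2"
    unfolding 3 by (simp add: power2_eq_square power3_eq_cube)
  show ?thesis
    using False unfolding 3 4
    by (intro exI[of _ "z $ 1"] exI[of _ 1] exI[of _ "z $ 2 / z $ 1"])
      (simp add: field_simps power2_eq_square power3_eq_cube)
qed

text \<open>
  Every point of the product of cones lies on a polynomial curve all of whose other nearby points are
  multiples of points \<open>embed x\<close> with \<open>c v\<^sub>k + d\<close> nonzero for all \<open>k\<close>.
\<close>

lemma vanishes_on_cone_product:
  fixes H :: "complex ^ 5 ^ 'n::finite \<Rightarrow> complex"
  assumes H: "H \<in> poly_funs" "multihomogeneous e H" and cd: "c \<noteq> 0 \<or> d \<noteq> 0"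
    and zero: "\<And>x. (\<forall>k. c * x $ k $ 1 + d \<noteq> 0) \<Longrightarrow> H (embed x) = 0"
    and z: "z \<in> cone_product"
  shows "H z = 0"
proof -
  have "\<forall>k. \<exists>s \<alpha> \<beta>. z $ k $ 1 = s * \<alpha>^3 \<and> z $ k $ 2 = s * \<alpha>^2 * \<beta>
      \<and> z $ k $ 3 = s * \<alpha> * \<beta>^2 \<and> z $ k $ 4 = s * \<beta>^3"
    using z cubic_cone_parametrization unfolding cone_product_def by blast
  then obtain s \<alpha> \<beta> where par: "\<And>k. z $ k $ 1 = s k * \<alpha> k^3"
      "\<And>k. z $ k $ 2 = s k * \<alpha> k^2 * \<beta> k"
      "\<And>k. z $ k $ 3 = s k * \<alpha> k * \<beta> k^2" "\<And>k. z $ k $ 4 = s k * \<beta> k^3"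
    by metis
  \<comment> \<open>The direction \<open>(1, q)\<close> for moving
    \<open>(\<alpha>, \<beta>)\<close> must lie off the line where
    \<open>c \<beta> + d \<alpha>\<close> vanishes: \<open>q = 0\<close> does if \<open>d\<close> is
    nonzero, and \<open>q = 1\<close> if \<open>d = 0\<close>, as then \<open>c\<close> is
    nonzero.\<close>
  define q :: complex where "q = (if d = 0 then 1 else 0)"
  have q: "c * q + d \<noteq> 0"
    using cd by (auto simp: q_def)
  \<comment> \<open>Moving all parameters linearly leaves the vertex, the points at infinity and the
    zeros of \<open>c v + d\<close> at once.\<close>
  define S A B where "S t k = s k + t" and "A t k = \<alpha> k + t" and "B t k = \<beta> k + t * q" for t k
  define \<gamma> :: "complex \<Rightarrow> complex ^ 5 ^ 'n" where
    "\<gamma> t = (\<chi> k. vector [S t k * A t k^3, S t k * A t k^2 * B t k, S t k * A t k * B t k^2,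
              S t k * B t k^3, z $ k $ 5])" for t
  have lim: "((\<lambda>t. H (\<gamma> t)) \<longlongrightarrow> H z) (at 0)"
  proof (rule poly_funs_tendsto[OF H(1)])
    fix k i
    have "\<forall>i. ((\<lambda>t. \<gamma> t $ k $ i) \<longlongrightarrow> z $ k $ i) (at 0)"
      unfolding forall_5 by (auto simp: \<gamma>_def par S_def A_def B_def intro!: tendsto_eq_intros)
    then show "((\<lambda>t. \<gamma> t $ k $ i) \<longlongrightarrow> z $ k $ i) (at 0)" by blast
  qed
  \<comment> \<open>A nonconstant affine function has a single zero, which a small punctured
    neighbourhood of 0 avoids.\<close>
  have linear: "\<forall>\<^sub>F t in at 0. a + t * b \<noteq> 0" if "b \<noteq> 0" for a b :: complex
  proof -
    have "\<forall>\<^sub>F t in at 0. t \<noteq> - a / b"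
      by (rule eventually_neq_at_within)
    then show ?thesis
      by eventually_elim (use that in \<open>auto simp: field_simps add_eq_0_iff2\<close>)
  qed
  have "\<forall>\<^sub>F t in at 0. \<forall>k. S t k \<noteq> 0 \<and> A t k \<noteq> 0 \<and> c * B t k + d * A t k \<noteq> 0"
  proof (rule eventually_all_finite)
    fix k
    have "\<forall>\<^sub>F t in at 0. s k + t * 1 \<noteq> 0 \<and> \<alpha> k + t * 1 \<noteq> 0
        \<and> (c * \<beta> k + d * \<alpha> k) + t * (c * q + d) \<noteq> 0"
      by (intro eventually_conj linear q) auto
    then show "\<forall>\<^sub>F t in at 0. S t k \<noteq> 0 \<and> A t k \<noteq> 0 \<and> c * B t k + d * A t k \<noteq> 0"
      by eventually_elim (simp add: S_def A_def B_def algebra_simps)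
  qed
  then have "\<forall>\<^sub>F t in at 0. H (\<gamma> t) = 0"
  proof eventually_elim
    case (elim t)
    \<comment> \<open>Each factor of \<open>\<gamma> t\<close> is dehomogenized by its first
      coordinate \<open>S t k * A t k^3\<close>.\<close>
    define x :: "complex ^ 2 ^ 'n" where
      "x = (\<chi> k. vector [B t k / A t k, z $ k $ 5 / (S t k * A t k^3)])"
    have "\<gamma> t $ k $ i = scale (\<lambda>k. S t k * A t k^3) (embed x) $ k $ i" for k i
    proof -
      have "\<forall>i. \<gamma> t $ k $ i = scale (\<lambda>k. S t k * A t k^3) (embed x) $ k $ i"
        unfolding forall_5 using elim
        by (simp add: \<gamma>_def scale_def x_def diagonal_def field_simps power2_eq_square power3_eq_cube)
      then show ?thesis by blast
    qed
    then have "\<gamma> t = scale (\<lambda>k. S t k * A t k^3) (embed x)"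
      by (simp add: vec_eq_iff)
    moreover have "c * x $ k $ 1 + d \<noteq> 0" for k
    proof -
      have "A t k * (c * x $ k $ 1 + d) = c * B t k + d * A t k"
        using elim by (simp add: x_def field_simps)
      then show ?thesis using elim by (metis mult_zero_right)
    qed
    ultimately show ?case
      using zero by (simp add: multihomogeneous_scale[OF H(2)])
  qed
  \<comment> \<open>Along the curve \<open>H\<close> tends both to 0 and, by continuity, to
    \<open>H z\<close>.\<close>
  then have "((\<lambda>t. H (\<gamma> t)) \<longlongrightarrow> 0) (at 0)"
    by (rule tendsto_eventually)
  then show ?thesis
    using lim by (intro tendsto_unique) auto
qed

section \<open>Compatibility of the embedding with the two actions\<close>

text \<open>The first four rows of \<open>cone_transf\<close> are the symmetric cube of a binary
  linear substitution: they send \<open>(1, v, v^2, v^3)\<close> to the cubic monomials in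
  \<open>c v + d\<close> and \<open>a v + b\<close>. The fifth row is the numerator of
  \<open>W\<close>.\<close>

lemma cone_transf_embedding:
  assumes "c * p $ 1 + d \<noteq> 0"
  shows "cone_transf a b c d l \<mu> \<nu> \<xi> (cauchy_embedding p)
    = (c * p $ 1 + d)^3 *s cauchy_embedding (cauchy_transf a b c d l \<mu> \<nu> \<xi> p)"
proof -
  define v w D where "v = p $ 1" and "w = p $ 2" and "D = c * v + d"
  have D: "D \<noteq> 0" using assms by (simp add: D_def v_def)
  have "d^3 + 3 * c * d^2 * v + 3 * c^2 * d * v^2 + c^3 * v^3 = D^3"
    "b * d^2 + d * (a * d + 2 * b * c) * v + c * (b * c + 2 * a * d) * v^2 + a * c^2 * v^3
      = D^2 * (a * v + b)"
    "b^2 * d + b * (b * c + 2 * a * d) * v + a * (a * d + 2 * b * c) * v^2 + a^2 * c * v^3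
      = D * (a * v + b)^2"
    "b^3 + 3 * a * b^2 * v + 3 * a^2 * b * v^2 + a^3 * v^3 = (a * v + b)^3"
    unfolding D_def by algebra+
  moreover have "D^3 * ((a * v + b) / D) = D^2 * (a * v + b)"
    "D^3 * ((a * v + b) / D)^2 = D * (a * v + b)^2"
    "D^3 * ((a * v + b) / D)^3 = (a * v + b)^3"
    using D by (simp_all add: field_simps power2_eq_square power3_eq_cube)
  ultimately show ?thesis
    using D unfolding vec_eq_iff forall_5
    by (simp add: cone_transf_def cauchy_transf_def Let_def flip: v_def w_def D_def)
qed

lemma diagonal_cone_transf_embed:
  assumes "\<forall>k. c * x $ k $ 1 + d \<noteq> 0"
  shows "diagonal (cone_transf a b c d l \<mu> \<nu> \<xi>) (embed x)
    = scale (\<lambda>k. (c * x $ k $ 1 + d)^3) (embed (diagonal (cauchy_transf a b c d l \<mu> \<nu> \<xi>) x))"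
  using assms by (simp add: vec_eq_iff[of "diagonal _ _"] diagonal_def scale_def cone_transf_embedding)

lemma poly_funs_cone_transf:
  fixes P :: "complex ^ 5 ^ 'n::finite \<Rightarrow> complex"
  assumes "P \<in> poly_funs"
  shows "(\<lambda>z. P (diagonal (cone_transf a b c d l \<mu> \<nu> \<xi>) z)) \<in> poly_funs"
proof (rule poly_funs_compose[OF assms])
  fix k :: 'n and i :: 5
  have "\<forall>i. (\<lambda>z :: complex ^ 5 ^ 'n. diagonal (cone_transf a b c d l \<mu> \<nu> \<xi>) z $ k $ i) \<in> poly_funs"
    unfolding forall_5
    by (auto simp: diagonal_def cone_transf_def Let_def intro!: poly_funs.intros)
  then show "(\<lambda>z :: complex ^ 5 ^ 'n. diagonal (cone_transf a b c d l \<mu> \<nu> \<xi>) z $ k $ i) \<in> poly_funs"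
    by blast
qed

lemma multihomogeneous_cone_transf:
  assumes "multihomogeneous e P"
  shows "multihomogeneous e (\<lambda>z. P (diagonal (cone_transf a b c d l \<mu> \<nu> \<xi>) z))"
proof (rule multihomogeneous_diagonal[OF assms])
  show "cone_transf a b c d l \<mu> \<nu> \<xi> (t *s z) = t *s cone_transf a b c d l \<mu> \<nu> \<xi> z" for t z
    unfolding vec_eq_iff forall_5 by (simp add: cone_transf_def Let_def algebra_simps)
qed

section \<open>Fractions\<close>

text \<open>The map \<open>E\<^sup>*\<close> on representatives; \<open>embedding_pullback\<close>
  is the map it induces on classes.\<close>

definition restrict_fraction :: "(5, 'n::finite) fraction \<Rightarrow> (2, 'n) fraction" where
  "restrict_fraction f = (fst f \<circ> embed, snd f \<circ> embed)"

text \<open>Only transitivity needs an argument: the middle denominator, which is merely not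
  identically zero, is cancelled by \<open>poly_funs_no_zero_divisors\<close>.\<close>

lemma equiv_same_cauchy_fraction:
  "equiv cauchy_fractions (same_fraction UNIV (cauchy_fractions :: (2, 'n::finite) fraction set))"
proof (rule equivI)
  show "same_fraction UNIV cauchy_fractions \<subseteq> cauchy_fractions \<times> cauchy_fractions"
    by (auto simp: same_fraction_def)
  show "refl_on cauchy_fractions (same_fraction UNIV cauchy_fractions)"
    by (auto simp: refl_on_def same_fraction_def)
  show "sym (same_fraction UNIV cauchy_fractions)"
    by (auto simp: sym_def same_fraction_def)
  show "trans (same_fraction UNIV (cauchy_fractions :: (2, 'n) fraction set))"
  proof (rule transI, clarify)
    fix p q p' q' p'' q'' :: "complex ^ 2 ^ 'n \<Rightarrow> complex"
    assume *: "((p, q), (p', q')) \<in> same_fraction UNIV cauchy_fractions"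
      "((p', q'), (p'', q'')) \<in> same_fraction UNIV cauchy_fractions"
    then have F: "p \<in> poly_funs" "q \<in> poly_funs" "q' \<in> poly_funs" "p'' \<in> poly_funs" "q'' \<in> poly_funs"
      and eq: "\<And>x. p x * q' x = p' x * q x" "\<And>x. p' x * q'' x = p'' x * q' x"
      by (auto simp: same_fraction_def cauchy_fractions_def)
    obtain x where x: "q' x \<noteq> 0"
      using * by (auto simp: same_fraction_def cauchy_fractions_def)
    have "p y * q'' y - p'' y * q y = 0" for y
    proof (rule poly_funs_no_zero_divisors[of q', OF F(3) _ _ x])
      show "(\<lambda>y. p y * q'' y - p'' y * q y) \<in> poly_funs"
        by (intro poly_funs_diff poly_funs.mult F)
      show "q' y * (p y * q'' y - p'' y * q y) = 0" for y
        using eq[of y] by algebra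
    qed
    then show "((p, q), (p'', q'')) \<in> same_fraction UNIV cauchy_fractions"
      using * by (auto simp: same_fraction_def)
  qed
qed

lemma same_cauchy_fraction_sym:
  "(f, g) \<in> same_fraction UNIV cauchy_fractions \<Longrightarrow> (g, f) \<in> same_fraction UNIV cauchy_fractions"
  by (auto simp: same_fraction_def)

lemma same_cauchy_fraction_trans:
  "(f, g) \<in> same_fraction UNIV cauchy_fractions \<Longrightarrow> (g, h) \<in> same_fraction UNIV cauchy_fractions \<Longrightarrow>
    (f, h) \<in> same_fraction UNIV cauchy_fractions"
  by (rule equivE[OF equiv_same_cauchy_fraction]) (rule transD)

text \<open>The denominator survives restriction, since by multihomogeneity it would otherwise
  vanish on the whole product of cones.\<close>

lemma restrict_fraction_in_cauchy_fractions:
  fixes f :: "(5, 'n::finite) fraction"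
  assumes "f \<in> cone_fractions"
  shows "restrict_fraction f \<in> cauchy_fractions"
proof -
  obtain P Q e z where f: "f = (P, Q)" "P \<in> poly_funs" "Q \<in> poly_funs" "multihomogeneous e Q"
    "z \<in> cone_product" "Q z \<noteq> 0"
    using assms by (auto simp: cone_fractions_def)
  \<comment> \<open>With \<open>c = 0\<close> and \<open>d = 1\<close> the condition on
    \<open>c v + d\<close> holds at every point.\<close>
  then obtain x where "Q (embed x) \<noteq> 0"
    using vanishes_on_cone_product[of Q e 0 1 z] by auto
  then show ?thesis
    using f poly_funs_embed
    by (auto simp: restrict_fraction_def cauchy_fractions_def comp_def)
qed

text \<open>Numerator and denominator are homogenized separately, and each is then multiplied by the
  homogenizing monomial of the other to equalize multidegrees.\<close>

lemma restrict_fraction_surj: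
  fixes g :: "(2, 'n::finite) fraction"
  assumes "g \<in> cauchy_fractions"
  shows "\<exists>f\<in>cone_fractions. restrict_fraction f = g"
proof -
  obtain p q x where g: "g = (p, q)" "p \<in> poly_funs" "q \<in> poly_funs" "q x \<noteq> 0"
    using assms by (auto simp: cauchy_fractions_def)
  obtain P e Q e' where P: "P \<in> poly_funs" "multihomogeneous e P" "\<forall>x. P (embed x) = p x"
    and Q: "Q \<in> poly_funs" "multihomogeneous e' Q" "\<forall>x. Q (embed x) = q x"
    using homogenization g by metis
  let ?P = "\<lambda>z. P z * homogenizing_monomial e' z" and ?Q = "\<lambda>z. homogenizing_monomial e z * Q z"
  have "?P \<in> poly_funs" "?Q \<in> poly_funs"
    by (intro poly_funs.mult P Q homogenizing_monomial)+
  moreover have "multihomogeneous (\<lambda>k. e k + e' k) ?P" "multihomogeneous (\<lambda>k. e k + e' k) ?Q"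
    by (intro multihomogeneous_mult P Q homogenizing_monomial)+
  moreover have "?Q (embed x) \<noteq> 0"
    using g Q by (simp add: homogenizing_monomial)
  ultimately have "(?P, ?Q) \<in> cone_fractions"
    unfolding cone_fractions_def using embed_in_cone_product by blast
  moreover have "restrict_fraction (?P, ?Q) = g"
    using P Q g by (simp add: restrict_fraction_def fun_eq_iff homogenizing_monomial)
  ultimately show ?thesis by blast
qed

text \<open>The difference \<open>?H\<close> of the cross products is multihomogeneous, so it
  vanishes on the product of cones as soon as it vanishes at the embedded points.\<close>

lemma same_cone_fraction_iff:
  fixes f g :: "(5, 'n::finite) fraction"
  assumes "f \<in> cone_fractions" "g \<in> cone_fractions"
  shows "(f, g) \<in> same_fraction cone_product cone_fractions \<longleftrightarrow>
    (restrict_fraction f, restrict_fraction g) \<in> same_fraction UNIV cauchy_fractions"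
proof -
  obtain P Q e where f: "f = (P, Q)" "P \<in> poly_funs" "Q \<in> poly_funs"
      "multihomogeneous e P" "multihomogeneous e Q"
    using assms by (auto simp: cone_fractions_def)
  obtain P' Q' e' where g: "g = (P', Q')" "P' \<in> poly_funs" "Q' \<in> poly_funs"
      "multihomogeneous e' P'" "multihomogeneous e' Q'"
    using assms by (auto simp: cone_fractions_def)
  let ?H = "\<lambda>z. P z * Q' z - Q z * P' z"
  have H: "?H \<in> poly_funs" "multihomogeneous (\<lambda>k. e k + e' k) ?H"
    by (intro poly_funs_diff poly_funs.mult multihomogeneous_diff multihomogeneous_mult f g)+
  have "(\<forall>z\<in>cone_product. ?H z = 0) \<longleftrightarrow> (\<forall>x. ?H (embed x) = 0)"
    using vanishes_on_cone_product[OF H, of 0 1] embed_in_cone_product by auto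
  then show ?thesis
    using assms restrict_fraction_in_cauchy_fractions[OF assms(1)]
      restrict_fraction_in_cauchy_fractions[OF assms(2)]
    by (simp add: f(1) g(1) same_fraction_def restrict_fraction_def mult.commute)
qed

lemma equiv_same_cone_fraction:
  "equiv cone_fractions (same_fraction cone_product (cone_fractions :: (5, 'n::finite) fraction set))"
    (is "equiv _ ?S")
proof (rule equivI)
  show sub: "?S \<subseteq> cone_fractions \<times> cone_fractions"
    by (auto simp: same_fraction_def)
  show "refl_on cone_fractions ?S"
    by (auto simp: refl_on_def same_fraction_def)
  show "sym ?S"
    by (auto simp: sym_def same_fraction_def)
  \<comment> \<open>Transitivity is transferred from the planes along
    \<open>restrict_fraction\<close>.\<close>
  show "trans ?S"
  proof (rule transI)
    fix f g h
    assume *: "(f, g) \<in> ?S" "(g, h) \<in> ?S"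
    then have "f \<in> cone_fractions" "g \<in> cone_fractions" "h \<in> cone_fractions"
      using sub by blast+
    then show "(f, h) \<in> ?S"
      using * by (simp add: same_cone_fraction_iff) (rule same_cauchy_fraction_trans)
  qed
qed

section \<open>The correspondence of rational functions\<close>

lemma embedding_pullback_eq:
  fixes R :: "(5, 'n::finite) ratfun"
  assumes "R \<subseteq> cone_fractions"
  shows "embedding_pullback R =
    {g. \<exists>f\<in>R. (g, restrict_fraction f) \<in> same_fraction UNIV cauchy_fractions}"
proof (rule set_eqI)
  fix g :: "(2, 'n) fraction"
  have same: "(g, restrict_fraction f) \<in> same_fraction UNIV cauchy_fractions \<longleftrightarrow>
      g \<in> cauchy_fractions \<and> (\<forall>x. fst g x * snd f (embed x) = fst f (embed x) * snd g x)"
    if "f \<in> R" for f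
  proof -
    have "restrict_fraction f \<in> cauchy_fractions"
      using that assms restrict_fraction_in_cauchy_fractions by blast
    then show ?thesis
      by (cases g) (simp add: same_fraction_def restrict_fraction_def)
  qed
  have "g \<in> embedding_pullback R \<longleftrightarrow>
      g \<in> cauchy_fractions \<and> (\<exists>f\<in>R. \<forall>x. fst g x * snd f (embed x) = fst f (embed x) * snd g x)"
    by (cases g) (simp add: embedding_pullback_def pullback_def case_prod_unfold)
  also have "\<dots> \<longleftrightarrow> (\<exists>f\<in>R. (g, restrict_fraction f) \<in> same_fraction UNIV cauchy_fractions)"
    by (simp add: same cong: bex_cong)
  finally show "g \<in> embedding_pullback R \<longleftrightarrow>
      g \<in> {g. \<exists>f\<in>R. (g, restrict_fraction f) \<in> same_fraction UNIV cauchy_fractions}"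
    by simp
qed

lemma cone_ratfun_subset: "R \<in> cone_ratfuns \<Longrightarrow> R \<subseteq> cone_fractions"
  unfolding cone_ratfuns_def
  using in_quotient_imp_subset[OF equiv_same_cone_fraction] .

text \<open>A class is thus recovered from its pullback, which yields injectivity. The forward
  direction holds because \<open>R\<close> is closed under equality of fractions.\<close>

lemma mem_cone_ratfun_iff:
  fixes R :: "(5, 'n::finite) ratfun"
  assumes R: "R \<in> cone_ratfuns" and f: "f \<in> cone_fractions"
  shows "restrict_fraction f \<in> embedding_pullback R \<longleftrightarrow> f \<in> R"
proof
  assume "restrict_fraction f \<in> embedding_pullback R"
  then obtain f' where f': "f' \<in> R"
    and "(restrict_fraction f, restrict_fraction f') \<in> same_fraction UNIV cauchy_fractions"
    using embedding_pullback_eq[OF cone_ratfun_subset[OF R]] by blast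
  then have "(f, f') \<in> same_fraction cone_product cone_fractions"
    using same_cone_fraction_iff f cone_ratfun_subset[OF R] by blast
  then have "(f', f) \<in> same_fraction cone_product cone_fractions"
    using equiv_same_cone_fraction by (metis equiv_def symD)
  then show "f \<in> R"
    using in_quotient_imp_closed[OF equiv_same_cone_fraction] R f' unfolding cone_ratfuns_def by blast
next
  assume "f \<in> R"
  moreover have "(restrict_fraction f, restrict_fraction f) \<in> same_fraction UNIV cauchy_fractions"
    using restrict_fraction_in_cauchy_fractions[OF f] by (auto simp: same_fraction_def)
  ultimately show "restrict_fraction f \<in> embedding_pullback R"
    using embedding_pullback_eq[OF cone_ratfun_subset[OF R]] by blast
qed

text \<open>Well-definedness: a change of representative on the cones gives an equal fraction on the
  planes.\<close>

lemma embedding_pullback_class: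
  fixes f :: "(5, 'n::finite) fraction"
  assumes "f \<in> cone_fractions"
  shows "embedding_pullback (same_fraction cone_product cone_fractions `` {f})
    = same_fraction UNIV cauchy_fractions `` {restrict_fraction f}" (is "embedding_pullback ?R = ?S")
proof -
  have "?R \<subseteq> cone_fractions"
    by (auto simp: same_fraction_def)
  then have "embedding_pullback ?R = {g. \<exists>f'\<in>?R. (g, restrict_fraction f') \<in> same_fraction UNIV cauchy_fractions}"
    by (rule embedding_pullback_eq)
  also have "\<dots> = ?S"
  proof (intro equalityI subsetI)
    fix g
    assume "g \<in> {g. \<exists>f'\<in>?R. (g, restrict_fraction f') \<in> same_fraction UNIV cauchy_fractions}"
    then obtain f' where f': "(f, f') \<in> same_fraction cone_product cone_fractions"
      "(g, restrict_fraction f') \<in> same_fraction UNIV cauchy_fractions"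
      by blast
    then have "f' \<in> cone_fractions" by (auto simp: same_fraction_def)
    then have "(restrict_fraction f, restrict_fraction f') \<in> same_fraction UNIV cauchy_fractions"
      using f' same_cone_fraction_iff assms by blast
    then have "(restrict_fraction f, g) \<in> same_fraction UNIV cauchy_fractions"
      by (rule same_cauchy_fraction_trans[OF _ same_cauchy_fraction_sym[OF f'(2)]])
    then show "g \<in> ?S" by simp
  next
    fix g assume "g \<in> ?S"
    then have "(g, restrict_fraction f) \<in> same_fraction UNIV cauchy_fractions"
      by (simp add: same_cauchy_fraction_sym)
    moreover have "f \<in> ?R"
      using equiv_class_self[OF equiv_same_cone_fraction assms] .
    ultimately show "g \<in> {g. \<exists>f'\<in>?R. (g, restrict_fraction f') \<in> same_fraction UNIV cauchy_fractions}"
      by blast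
  qed
  finally show ?thesis .
qed

lemma bij_betw_embedding_pullback:
  "bij_betw (embedding_pullback :: (5, 'n::finite) ratfun \<Rightarrow> _) cone_ratfuns cauchy_ratfuns"
proof (rule bij_betwI')
  fix R R' :: "(5, 'n) ratfun"
  assume R: "R \<in> cone_ratfuns" "R' \<in> cone_ratfuns"
  \<comment> \<open>Injectivity: \<open>R\<close> is the preimage of its pullback under
    \<open>restrict_fraction\<close>.\<close>
  have "R = {f \<in> cone_fractions. restrict_fraction f \<in> embedding_pullback R}"
    if "R \<in> cone_ratfuns" for R :: "(5, 'n) ratfun"
    using mem_cone_ratfun_iff[OF that] cone_ratfun_subset[OF that] by blast
  from this[OF R(1)] this[OF R(2)] show "embedding_pullback R = embedding_pullback R' \<longleftrightarrow> R = R'"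
    by auto
next
  fix R :: "(5, 'n) ratfun"
  assume "R \<in> cone_ratfuns"
  then obtain f where f: "f \<in> cone_fractions"
    and R: "R = same_fraction cone_product cone_fractions `` {f}"
    unfolding cone_ratfuns_def by (rule quotientE)
  show "embedding_pullback R \<in> cauchy_ratfuns"
    unfolding cauchy_ratfuns_def R embedding_pullback_class[OF f]
    by (intro quotientI restrict_fraction_in_cauchy_fractions f)
next
  fix S :: "(2, 'n) ratfun"
  assume "S \<in> cauchy_ratfuns"
  then obtain g where "g \<in> cauchy_fractions" and S: "S = same_fraction UNIV cauchy_fractions `` {g}"
    unfolding cauchy_ratfuns_def by (rule quotientE)
  then obtain f where f: "f \<in> cone_fractions" "restrict_fraction f = g"
    using restrict_fraction_surj by blast
  show "\<exists>R\<in>cone_ratfuns. S = embedding_pullback R"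
  proof
    show "S = embedding_pullback (same_fraction cone_product cone_fractions `` {f})"
      unfolding S embedding_pullback_class[OF f(1)] f(2) ..
    show "same_fraction cone_product cone_fractions `` {f} \<in> cone_ratfuns"
      unfolding cone_ratfuns_def by (rule quotientI[OF f(1)])
  qed
qed

section \<open>The correspondence of invariants\<close>

text \<open>As \<open>cone_transf\<close> is linear, \<open>?H\<close> is again multihomogeneous and
  can be tested at embedded points in the domain of \<open>\<psi>\<close>. There
  \<open>\<phi> (embed x)\<close> is a multiple of \<open>embed (\<psi> x)\<close>, and the scalars
  cancel.\<close>

lemma fraction_pullback_iff:
  fixes f g :: "(5, 'n::finite) fraction" and l \<mu> \<nu> \<xi> :: complex
  assumes f: "f \<in> cone_fractions" and g: "g \<in> cone_fractions" and cd: "a * d - b * c \<noteq> 0"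
  defines "\<phi> \<equiv> diagonal (cone_transf a b c d l \<mu> \<nu> \<xi>)"
    and "\<psi> \<equiv> diagonal (cauchy_transf a b c d l \<mu> \<nu> \<xi>)"
  shows "(\<forall>z\<in>cone_product. fst f z * snd g (\<phi> z) = fst g (\<phi> z) * snd f z) \<longleftrightarrow>
    (\<forall>x\<in>{x. \<forall>k. c * x $ k $ 1 + d \<noteq> 0}.
       fst f (embed x) * snd g (embed (\<psi> x)) = fst g (embed (\<psi> x)) * snd f (embed x))"
    (is "?L \<longleftrightarrow> ?R")
proof -
  obtain P Q e where f: "f = (P, Q)" "P \<in> poly_funs" "Q \<in> poly_funs"
      "multihomogeneous e P" "multihomogeneous e Q"
    using f by (auto simp: cone_fractions_def)
  obtain P' Q' e' where g: "g = (P', Q')" "P' \<in> poly_funs" "Q' \<in> poly_funs"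
      "multihomogeneous e' P'" "multihomogeneous e' Q'"
    using g by (auto simp: cone_fractions_def)
  let ?D = "\<lambda>x :: complex ^ 2 ^ 'n. \<forall>k. c * x $ k $ 1 + d \<noteq> 0"
  let ?H = "\<lambda>z. P z * Q' (\<phi> z) - Q z * P' (\<phi> z)"
  have H: "?H \<in> poly_funs" "multihomogeneous (\<lambda>k. e k + e' k) ?H"
    unfolding \<phi>_def
    by (intro poly_funs_diff poly_funs.mult multihomogeneous_diff multihomogeneous_mult
        poly_funs_cone_transf multihomogeneous_cone_transf f g)+
  have cancel: "?H (embed x) = 0 \<longleftrightarrow>
      P (embed x) * Q' (embed (\<psi> x)) = P' (embed (\<psi> x)) * Q (embed x)" if "?D x" for x
  proof -
    \<comment> \<open>The factor produced by scaling; it is the same for \<open>P'\<close> and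
      \<open>Q'\<close> because they share the multidegree \<open>e'\<close>.\<close>
    define m where "m = (\<Prod>k\<in>UNIV. ((c * x $ k $ 1 + d)^3) ^ e' k)"
    have "m \<noteq> 0" using that by (simp add: m_def)
    moreover have "P' (\<phi> (embed x)) = m * P' (embed (\<psi> x))" "Q' (\<phi> (embed x)) = m * Q' (embed (\<psi> x))"
      unfolding \<phi>_def \<psi>_def m_def diagonal_cone_transf_embed[OF that]
      by (intro multihomogeneous_scale g)+
    moreover have "P (embed x) * (m * Q' (embed (\<psi> x))) - Q (embed x) * (m * P' (embed (\<psi> x)))
        = m * (P (embed x) * Q' (embed (\<psi> x)) - P' (embed (\<psi> x)) * Q (embed x))"
      by (simp add: algebra_simps)
    ultimately show ?thesis by simp
  qed
  have "c \<noteq> 0 \<or> d \<noteq> 0" using cd by auto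
  then have "(\<forall>z\<in>cone_product. ?H z = 0) \<longleftrightarrow> (\<forall>x. ?D x \<longrightarrow> ?H (embed x) = 0)"
    using vanishes_on_cone_product[OF H] embed_in_cone_product by blast
  then show ?thesis
    using cancel by (simp add: f(1) g(1) mult.commute)
qed

text \<open>Pulling back along the embedding intertwines the two actions, expressed on
  representatives.\<close>

lemma mem_pullback_iff:
  fixes R :: "(5, 'n::finite) ratfun"
  assumes R: "R \<in> cone_ratfuns" and f: "f \<in> cone_fractions" and cd: "a * d - b * c \<noteq> 0"
  shows "f \<in> pullback cone_fractions cone_product (diagonal (cone_transf a b c d l \<mu> \<nu> \<xi>)) R \<longleftrightarrow>
    restrict_fraction f \<in> pullback cauchy_fractions {x. \<forall>k. c * x $ k $ 1 + d \<noteq> 0}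
      (diagonal (cauchy_transf a b c d l \<mu> \<nu> \<xi>)) (embedding_pullback R)"
proof -
  let ?\<phi> = "diagonal (cone_transf a b c d l \<mu> \<nu> \<xi>) :: complex ^ 5 ^ 'n \<Rightarrow> _"
  let ?\<psi> = "diagonal (cauchy_transf a b c d l \<mu> \<nu> \<xi>) :: complex ^ 2 ^ 'n \<Rightarrow> _"
  let ?D = "{x :: complex ^ 2 ^ 'n. \<forall>k. c * x $ k $ 1 + d \<noteq> 0}"
  have "f \<in> pullback cone_fractions cone_product ?\<phi> R \<longleftrightarrow>
      (\<exists>g\<in>R. \<forall>z\<in>cone_product. fst f z * snd g (?\<phi> z) = fst g (?\<phi> z) * snd f z)"
    using f by (cases f) (simp add: pullback_def case_prod_unfold)
  also have "\<dots> \<longleftrightarrow> (\<exists>g\<in>R. \<forall>x\<in>?D. fst f (embed x) * snd g (embed (?\<psi> x))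
      = fst g (embed (?\<psi> x)) * snd f (embed x))"
    using fraction_pullback_iff[OF f _ cd] cone_ratfun_subset[OF R] by (intro bex_cong refl) blast
  also have "\<dots> \<longleftrightarrow> (\<exists>h\<in>restrict_fraction ` R. \<forall>x\<in>?D. fst f (embed x) * snd h (?\<psi> x)
      = fst h (?\<psi> x) * snd f (embed x))"
    by (simp add: restrict_fraction_def)
  \<comment> \<open>Every representative of the pulled-back class lifts to a fraction on the cones,
    which then lies in \<open>R\<close>; so quantifying over \<open>R\<close> or over its pullback
    amounts to the same.\<close>
  also have "restrict_fraction ` R = embedding_pullback R"
  proof (intro equalityI subsetI)
    fix h assume "h \<in> restrict_fraction ` R"
    then show "h \<in> embedding_pullback R"
      using mem_cone_ratfun_iff[OF R] cone_ratfun_subset[OF R] by blast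
  next
    fix h assume h: "h \<in> embedding_pullback R"
    then have "h \<in> cauchy_fractions"
      by (auto simp: embedding_pullback_def pullback_def)
    then show "h \<in> restrict_fraction ` R"
      using h restrict_fraction_surj mem_cone_ratfun_iff[OF R] by blast
  qed
  also have "(\<exists>h\<in>embedding_pullback R. \<forall>x\<in>?D. fst f (embed x) * snd h (?\<psi> x)
      = fst h (?\<psi> x) * snd f (embed x)) \<longleftrightarrow>
      restrict_fraction f \<in> pullback cauchy_fractions ?D ?\<psi> (embedding_pullback R)"
    using restrict_fraction_in_cauchy_fractions[OF f]
    by (simp add: pullback_def restrict_fraction_def case_prod_unfold)
  finally show ?thesis .
qed

lemma embedding_pullback_invariant_iff:
  fixes R :: "(5, 'n::finite) ratfun"
  assumes R: "R \<in> cone_ratfuns" and cd: "a * d - b * c \<noteq> 0"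
  shows "pullback cone_fractions cone_product (diagonal (cone_transf a b c d l \<mu> \<nu> \<xi>)) R = R \<longleftrightarrow>
    pullback cauchy_fractions {x. \<forall>k. c * x $ k $ 1 + d \<noteq> 0}
      (diagonal (cauchy_transf a b c d l \<mu> \<nu> \<xi>)) (embedding_pullback R) = embedding_pullback R"
    (is "?A = R \<longleftrightarrow> ?B = ?S")
proof
  assume A: "?A = R"
  show "?B = ?S"
  proof (rule set_eqI)
    fix g
    show "g \<in> ?B \<longleftrightarrow> g \<in> ?S"
    \<comment> \<open>Both sides contain only admissible fractions, and an admissible
      \<open>g\<close> lifts to the cones, where \<open>A\<close> applies.\<close>
    proof (cases "g \<in> cauchy_fractions")
      case True
      then obtain f where f: "f \<in> cone_fractions" "restrict_fraction f = g"
        using restrict_fraction_surj by blast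
      show ?thesis
        unfolding f(2)[symmetric] mem_pullback_iff[OF R f(1) cd, symmetric]
          mem_cone_ratfun_iff[OF R f(1)] A ..
    next
      case False
      then show ?thesis by (auto simp: pullback_def embedding_pullback_def)
    qed
  qed
next
  assume B: "?B = ?S"
  show "?A = R"
  proof (rule set_eqI)
    fix f
    show "f \<in> ?A \<longleftrightarrow> f \<in> R"
    proof (cases "f \<in> cone_fractions")
      case True
      show ?thesis
        using mem_pullback_iff[OF R True cd] mem_cone_ratfun_iff[OF R True] B by simp
    next
      case False
      then have "f \<notin> ?A" by (auto simp: pullback_def)
      then show ?thesis using False cone_ratfun_subset[OF R] by blast
    qed
  qed
qed

theorem theorem4p2:
  assumes "CARD('n::finite) \<ge> 4"
  shows "bij_betw (embedding_pullback :: (5, 'n) ratfun \<Rightarrow> (2, 'n) ratfun)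
           cone_invariants cauchy_invariants"
proof -
  note bij = bij_betw_embedding_pullback[where 'n = 'n]
  \<comment> \<open>Invariance is compared for each choice of the eight parameters, which are shared
    by the two groups.\<close>
  have inv: "R \<in> cone_invariants \<longleftrightarrow> embedding_pullback R \<in> cauchy_invariants"
    if R: "R \<in> cone_ratfuns" for R :: "(5, 'n) ratfun"
    unfolding cone_invariants_def cauchy_invariants_def
    using R bij_betw_apply[OF bij R] by (simp add: embedding_pullback_invariant_iff[OF R])
  have sub: "cone_invariants \<subseteq> (cone_ratfuns :: (5, 'n) ratfun set)"
    by (auto simp: cone_invariants_def)
  have "embedding_pullback ` cone_invariants = (cauchy_invariants :: (2, 'n) ratfun set)"
  proof (intro equalityI subsetI)
    fix S :: "(2, 'n) ratfun"
    assume "S \<in> embedding_pullback ` cone_invariants"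
    then show "S \<in> cauchy_invariants" using inv sub by blast
  next
    fix S :: "(2, 'n) ratfun"
    assume S: "S \<in> cauchy_invariants"
    \<comment> \<open>An invariant on the planes is first lifted as a mere rational function;
      \<open>inv\<close> then shows that the lift is invariant.\<close>
    then have "S \<in> embedding_pullback ` cone_ratfuns"
      using bij_betw_imp_surj_on[OF bij] by (simp add: cauchy_invariants_def)
    then obtain R where "R \<in> cone_ratfuns" "S = embedding_pullback R"
      by blast
    then show "S \<in> embedding_pullback ` cone_invariants" using inv S by blast
  qed
  then show ?thesis
    by (rule bij_betw_subset[OF bij sub])
qed

end
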